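(* Let $q>1$ and let $(n_k)_{k \geq 1}$ be a sequence of positive integers satisfying $\frac{n_{k+1}}{n_k} \geq q$ for all $k \geq 1$. Then there exists a constant $C>0$ depending only on $q$ such that the following holds: for all $\lambda \in [-1,1]$, $$ \int_0^1 \exp \left( \lambda \sum_{k=1}^N \sqrt{2}\cos(2 \pi n_k x) \right) \mathrm{d}x = \exp \left( \frac{\lambda^2N}{2} + \mathcal{O} \left(\lambda^{3} N \right) \right) $$ as $N \to \infty$, where the implied constant in the $\mathcal{O}$-term depends only on $q$; that is, for all sufficiently large $N$ and all $\lambda\in[-1,1]$, the logarithm of the integral differs from $\frac{\lambda^2 N}{2}$ by at most $C|\lambda|^3 N$.
   Context: The integral is with respect to Lebesgue measure on $(0,1)$. *)

theory Defs
  imports "HOL-Analysis.Analysis"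
begin

end

theory Submission
  imports Defs
begin

text \<open>
  For small \<open>l\<close>, \<open>exp (l * c - l\<^sup>2 / 2) = (1 + l * c + l\<^sup>2 / 2 * (c\<^sup>2 - 1)) * exp (O(l\<^sup>3))\<close>, and
  \<open>c\<^sup>2 - 1 = cos (2 * t)\<close> if \<open>c = sqrt 2 * cos t\<close>. This reduces the claim to showing that the Riesz
  product \<open>F N\<close> with factors \<open>1 + l * sqrt 2 * cos t\<^sub>k + l\<^sup>2 / 2 * cos (2 * t\<^sub>k)\<close>,
  \<open>t\<^sub>k = 2 * pi * n k * x\<close>, has mean \<open>exp (O(l\<^sup>3 * N))\<close>, which holds because the means of
  \<open>F (Suc N)\<close> and \<open>F N\<close> differ by a factor \<open>1 + O(l\<^sup>3)\<close>. Indeed, split off the last \<open>r\<close> factors of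
  \<open>F N\<close>, with \<open>r\<close> depending only on \<open>q\<close>. What remains is a nonnegative cosine polynomial whose
  degree is small compared to \<open>n (Suc N)\<close>, and the \<open>r\<close> factors multiply to
  \<open>1 + l * (\<Sum> sqrt 2 * cos t\<^sub>k) + O(l\<^sup>2)\<close>. By lacunarity the first two terms contribute nothing to
  the correlation with \<open>cos t\<^bsub>Suc N\<^esub>\<close>, which is therefore \<open>O(l\<^sup>2)\<close> times the mean; in the same way
  the correlation with \<open>cos (2 * t\<^bsub>Suc N\<^esub>)\<close> is \<open>O(l)\<close> times the mean. If \<open>l\<close> is bounded away from
  \<open>0\<close>, the trivial bound on the integrand suffices.
\<close>

subsection \<open>Cosine polynomials\<close>

lemma integral_cos_multiple:
  fixes m :: nat
  assumes "m > 0"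
  shows "integral {0..1} (\<lambda>x. cos (2 * pi * real m * x)) = 0"
proof -
  have "((\<lambda>x. cos (2 * pi * real m * x)) has_integral
      sin (2 * pi * real m * 1) / (2 * pi * real m) - sin (2 * pi * real m * 0) / (2 * pi * real m)) {0..1}"
    using assms
    by (intro fundamental_theorem_of_calculus)
       (auto intro!: derivative_eq_intros simp flip: has_real_derivative_iff_has_vector_derivative)
  moreover have "sin (2 * pi * real m) = 0"
    using sin_npi2[of "2 * m"] by (simp add: mult_ac)
  ultimately show ?thesis by (simp add: integral_unique)
qed

text \<open>\<open>D\<close> is only an upper bound for the frequencies, constants are the case
  \<open>j = 0\<close>, and the coefficient sits inside the monomial, so that inductions have just
  two cases.\<close>

inductive cos_poly :: "nat \<Rightarrow> (real \<Rightarrow> real) \<Rightarrow> bool" for D where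
  monomial: "j \<le> D \<Longrightarrow> cos_poly D (\<lambda>x. c * cos (2 * pi * real j * x))"
| add: "cos_poly D f \<Longrightarrow> cos_poly D g \<Longrightarrow> cos_poly D (\<lambda>x. f x + g x)"

lemma cos_poly_mono: "cos_poly D f \<Longrightarrow> D \<le> D' \<Longrightarrow> cos_poly D' f"
  by (induction rule: cos_poly.induct) (auto intro: cos_poly.intros)

lemma continuous_on_cos_poly: "cos_poly D f \<Longrightarrow> continuous_on S f"
  by (induction rule: cos_poly.induct) (auto intro!: continuous_intros)

text \<open>Product-to-sum: frequencies \<open>j\<close> and \<open>n\<close> produce
  \<open>j + n\<close> and the distance of \<open>j\<close> and \<open>n\<close>, both at most
  \<open>D + n\<close>.\<close>

lemma cos_poly_mult_cos:
  assumes "cos_poly D f"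
  shows "cos_poly (D + n) (\<lambda>x. f x * (c * cos (2 * pi * real n * x)))"
  using assms
proof induction
  case (monomial j a)
  \<comment> \<open>Frequencies are natural numbers, so the difference is taken in the order that
    avoids truncation; evenness of the cosine makes the order irrelevant.\<close>
  define d where "d = (if j \<le> n then n - j else j - n)"
  have d: "cos (2 * pi * real d * x) = cos (2 * pi * real j * x - 2 * pi * real n * x)" for x
  proof (cases "j \<le> n")
    case True
    then have "2 * pi * real d * x = - (2 * pi * real j * x - 2 * pi * real n * x)"
      by (simp add: d_def of_nat_diff algebra_simps)
    then show ?thesis by (metis cos_minus)
  qed (simp add: d_def of_nat_diff algebra_simps)
  have "(\<lambda>x. a * cos (2 * pi * real j * x) * (c * cos (2 * pi * real n * x))) =
      (\<lambda>x. (a * c / 2) * cos (2 * pi * real d * x) + (a * c / 2) * cos (2 * pi * real (j + n) * x))"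
    unfolding d by (simp add: fun_eq_iff cos_diff cos_add algebra_simps)
  moreover have "cos_poly (D + n) \<dots>"
    using monomial by (intro cos_poly.intros) (auto simp: d_def)
  ultimately show ?case by simp
next
  case (add f g)
  then show ?case
    by (simp add: distrib_right cos_poly.add)
qed

text \<open>Orthogonality: \<open>j \<le> D < m\<close> keeps both \<open>m - j\<close> and
  \<open>m + j\<close> positive, so no constant term arises.\<close>

lemma integral_cos_poly_mult_cos:
  assumes "cos_poly D f" "D < m"
  shows "integral {0..1} (\<lambda>x. f x * cos (2 * pi * real m * x)) = 0"
  using assms
proof induction
  case (monomial j a)
  have "(\<lambda>x. a * cos (2 * pi * real j * x) * cos (2 * pi * real m * x)) =
      (\<lambda>x. (a / 2) * cos (2 * pi * real (m - j) * x) + (a / 2) * cos (2 * pi * real (m + j) * x))"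
    using monomial by (simp add: fun_eq_iff cos_diff cos_add algebra_simps of_nat_diff)
  moreover have "integral {0..1} \<dots> =
      integral {0..1} (\<lambda>x. (a / 2) * cos (2 * pi * real (m - j) * x)) +
      integral {0..1} (\<lambda>x. (a / 2) * cos (2 * pi * real (m + j) * x))"
    by (intro integral_add integrable_continuous_real continuous_intros)
  moreover have "\<dots> = 0"
    using monomial integral_cos_multiple[of "m - j"] integral_cos_multiple[of "m + j"] by simp
  ultimately show ?case by metis
next
  case (add f g)
  then show ?case
    by (simp add: distrib_right integral_add integrable_continuous_real continuous_intros
        continuous_on_cos_poly)
qed

subsection \<open>Riesz products\<close>

text \<open>Written by frequencies \<open>m\<close> and \<open>2 * m\<close>, the form suited to
  orthogonality; the polynomial form in the cosine, suited to comparison with the exponential, is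
  \<open>riesz_factor_eq\<close>.\<close>

definition riesz_factor :: "real \<Rightarrow> nat \<Rightarrow> real \<Rightarrow> real" where
  "riesz_factor l m x =
     1 + l * (sqrt 2 * cos (2 * pi * real m * x)) + l\<^sup>2 * (cos (2 * pi * real (2 * m) * x) / 2)"

definition riesz_product :: "real \<Rightarrow> (nat \<Rightarrow> nat) \<Rightarrow> nat \<Rightarrow> real \<Rightarrow> real" where
  "riesz_product l n N x = (\<Prod>k=1..N. riesz_factor l (n k) x)"

lemma riesz_product_0 [simp]: "riesz_product l n 0 x = 1"
  by (simp add: riesz_product_def)

lemma riesz_product_Suc:
  "riesz_product l n (Suc N) x = riesz_product l n N x * riesz_factor l (n (Suc N)) x"
  by (simp add: riesz_product_def)

lemma abs_sqrt2_cos_le: "\<bar>sqrt 2 * cos t\<bar> \<le> 3 / 2"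
proof -
  have "sqrt 2 \<le> 3 / 2" by (rule real_le_lsqrt) (auto simp: power2_eq_square)
  then show ?thesis
    using mult_mono[of "sqrt 2" "3/2" "\<bar>cos t\<bar>" 1] by (simp add: abs_mult)
qed

lemma riesz_factor_eq:
  "riesz_factor l m x = 1 + l * c + l\<^sup>2 * (c\<^sup>2 - 1) / 2"
  if "c = sqrt 2 * cos (2 * pi * real m * x)"
proof -
  have "cos (2 * pi * real (2 * m) * x) = c\<^sup>2 - 1"
    using cos_double_cos[of "2 * pi * real m * x"] that by (simp add: power_mult_distrib mult_ac)
  then show ?thesis by (simp add: riesz_factor_def that)
qed

text \<open>The two nonconstant terms are at most 3/8 and 1/32 in absolute value.\<close>

lemma riesz_factor_ge_half:
  assumes "\<bar>l\<bar> \<le> 1 / 4"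
  shows "riesz_factor l m x \<ge> 1 / 2"
proof -
  have "\<bar>l * (sqrt 2 * cos (2 * pi * real m * x))\<bar> \<le> 1 / 4 * (3 / 2)"
    unfolding abs_mult[of l] using assms abs_sqrt2_cos_le by (intro mult_mono) auto
  moreover have "l\<^sup>2 \<le> (1 / 4)\<^sup>2"
    using assms power_mono[of "\<bar>l\<bar>" "1/4" 2] by simp
  then have "\<bar>l\<^sup>2 * (cos (2 * pi * real (2 * m) * x) / 2)\<bar> \<le> (1 / 4)\<^sup>2 * (1 / 2)"
    unfolding abs_mult[of "l\<^sup>2"] by (intro mult_mono) auto
  ultimately show ?thesis
    unfolding riesz_factor_def by (simp add: power2_eq_square abs_le_iff)
qed

lemma riesz_product_pos: "\<bar>l\<bar> \<le> 1 / 4 \<Longrightarrow> riesz_product l n N x > 0"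
  unfolding riesz_product_def
  by (intro prod_pos ballI less_le_trans[OF _ riesz_factor_ge_half]) auto

lemma continuous_on_riesz_factor [continuous_intros]: "continuous_on S (riesz_factor l m)"
  unfolding riesz_factor_def by (intro continuous_intros) auto

lemma continuous_on_riesz_product [continuous_intros]: "continuous_on S (riesz_product l n N)"
  unfolding riesz_product_def by (intro continuous_intros)

text \<open>The top frequency of each factor is \<open>2 * n k\<close>, and degrees add under
  multiplication.\<close>

lemma cos_poly_riesz_product: "cos_poly (\<Sum>k=1..N. 2 * n k) (riesz_product l n N)"
proof (induction N)
  case 0
  then show ?case using cos_poly.monomial[of 0 0 1] by (simp add: riesz_product_def)
next
  case (Suc N)
  let ?D = "\<Sum>k=1..N. 2 * n k" and ?F = "riesz_product l n N" and ?m = "n (Suc N)"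
  have "riesz_product l n (Suc N) = (\<lambda>x. ?F x
      + ?F x * ((l * sqrt 2) * cos (2 * pi * real ?m * x))
      + ?F x * ((l\<^sup>2 / 2) * cos (2 * pi * real (2 * ?m) * x)))"
    by (simp add: fun_eq_iff riesz_product_Suc riesz_factor_def algebra_simps)
  moreover have "cos_poly (?D + 2 * ?m) \<dots>"
    by (intro cos_poly.add cos_poly_mult_cos Suc cos_poly_mono[OF cos_poly_mult_cos[OF Suc]]
          cos_poly_mono[OF Suc]) auto
  ultimately show ?case by simp
qed

section \<open>Correlations with a new frequency and the mean of a Riesz product\<close>

text \<open>Induction on the number of factors. One more factor turns the remainder coefficient
  \<open>7 ^ r\<close> into at most \<open>5 * r + 1 / 2 + 7 / 2 * 7 ^ r\<close>, and
  \<open>1 + 2 * r \<le> 7 ^ r\<close> bounds this by \<open>6 * 7 ^ r\<close>.\<close>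

lemma prod_second_order_bound:
  fixes l :: real and a b :: "nat \<Rightarrow> real"
  assumes "\<bar>l\<bar> \<le> 1" "\<And>k. \<bar>a k\<bar> \<le> 2" "\<And>k. \<bar>b k\<bar> \<le> 1 / 2"
  shows "\<bar>(\<Prod>k<r. 1 + l * a k + l\<^sup>2 * b k) - 1 - l * (\<Sum>k<r. a k)\<bar> \<le> 7 ^ r * l\<^sup>2"
proof (induction r)
  case (Suc r)
  define A where "A = (\<Sum>k<r. a k)"
  define R where "R = (\<Prod>k<r. 1 + l * a k + l\<^sup>2 * b k) - 1 - l * A"
  have R: "\<bar>R\<bar> \<le> 7 ^ r * l\<^sup>2" using Suc by (simp add: R_def A_def)
  have A: "\<bar>A\<bar> \<le> 2 * real r"
    unfolding A_def using sum_norm_le[of "{..<r}" a "\<lambda>_. 2"] assms(2) by (simp add: mult_ac)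
  have l2: "l\<^sup>2 \<le> 1" using assms(1) by (simp add: abs_square_le_1)
  have 1: "\<bar>l\<^sup>2 * (A * a r)\<bar> \<le> l\<^sup>2 * (2 * real r * 2)"
    unfolding abs_mult using A assms(2) by (intro mult_mono) auto
  have 2: "\<bar>R * (l * a r)\<bar> \<le> (7 ^ r * l\<^sup>2) * (1 * 2)"
    unfolding abs_mult using R assms by (intro mult_mono) auto
  have 3: "\<bar>l\<^sup>2 * (b r * (l * A))\<bar> \<le> l\<^sup>2 * (1 / 2 * (1 * (2 * real r)))"
    unfolding abs_mult using A assms by (intro mult_mono) auto
  have 4: "\<bar>R * (l\<^sup>2 * b r)\<bar> \<le> (7 ^ r * l\<^sup>2) * (1 * (1 / 2))"
    unfolding abs_mult using R assms l2 by (intro mult_mono) auto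
  have 5: "\<bar>l\<^sup>2 * b r\<bar> \<le> l\<^sup>2 * (1 / 2)"
    unfolding abs_mult using assms by (intro mult_mono) auto
  have 6: "1 + 2 * real r \<le> 7 ^ r"
    using Bernoulli_inequality[of "6 :: real" r] by simp
  have "(\<Prod>k<Suc r. 1 + l * a k + l\<^sup>2 * b k) - 1 - l * (\<Sum>k<Suc r. a k) =
      (1 + l * A + R) * (1 + l * a r + l\<^sup>2 * b r) - 1 - l * (A + a r)"
    by (simp add: R_def A_def)
  moreover have "\<dots> = l\<^sup>2 * (A * a r) + R + R * (l * a r) + l\<^sup>2 * b r + l\<^sup>2 * (b r * (l * A)) + R * (l\<^sup>2 * b r)"
    by (simp add: algebra_simps power2_eq_square)
  ultimately have "\<bar>(\<Prod>k<Suc r. 1 + l * a k + l\<^sup>2 * b k) - 1 - l * (\<Sum>k<Suc r. a k)\<bar>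
      \<le> l\<^sup>2 * (2 * real r * 2) + 7 ^ r * l\<^sup>2 + (7 ^ r * l\<^sup>2) * (1 * 2) + l\<^sup>2 * (1 / 2)
      + l\<^sup>2 * (1 / 2 * (1 * (2 * real r))) + (7 ^ r * l\<^sup>2) * (1 * (1 / 2))"
    by (simp only:) (intro order_trans[OF abs_triangle_ineq] add_mono 1 2 3 4 5 R)
  also have "\<dots> = l\<^sup>2 * (5 * real r + 1 / 2 + 7 / 2 * 7 ^ r)"
    by (simp add: field_simps)
  also have "\<dots> \<le> l\<^sup>2 * 7 ^ Suc r"
    using 6 by (intro mult_left_mono) auto
  finally show ?case by (simp add: mult_ac)
qed simp

lemma riesz_product_split:
  "riesz_product l n (M + r) x =
     riesz_product l n M x * (\<Prod>k<r. riesz_factor l (n (Suc (M + k))) x)"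
  by (induction r) (simp_all add: riesz_product_Suc)

lemma integral_riesz_product_pos:
  assumes "\<bar>l\<bar> \<le> 1 / 4"
  shows "integral {0..1} (riesz_product l n N) > 0"
proof -
  have "riesz_product l n N x \<ge> (1 / 2) ^ N" for x
    unfolding riesz_product_def
    using prod_mono[of "{1..N}" "\<lambda>_. 1 / 2" "\<lambda>k. riesz_factor l (n k) x"]
      riesz_factor_ge_half[OF assms] by simp
  then have "integral {0..1} (\<lambda>x::real. (1 / 2) ^ N :: real) \<le> integral {0..1} (riesz_product l n N)"
    by (intro integral_le integrable_continuous_real continuous_intros) auto
  moreover have "integral {0..1} (\<lambda>x::real. (1 / 2) ^ N :: real) > 0" by simp
  ultimately show ?thesis by linarith
qed

text \<open>Each of the \<open>r\<close> extra factors is at least 1/2. This converts bounds by the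
  mean of a truncated product into bounds by the mean of the full one.\<close>

lemma integral_riesz_product_split_le:
  assumes "\<bar>l\<bar> \<le> 1 / 4"
  shows "integral {0..1} (riesz_product l n M) \<le> 2 ^ r * integral {0..1} (riesz_product l n (M + r))"
proof -
  have "riesz_product l n M x \<le> 2 ^ r * riesz_product l n (M + r) x" for x
  proof -
    have "(1 / 2) ^ r \<le> (\<Prod>k<r. riesz_factor l (n (Suc (M + k))) x)"
      using prod_mono[of "{..<r}" "\<lambda>_. 1 / 2" "\<lambda>k. riesz_factor l (n (Suc (M + k))) x"]
        riesz_factor_ge_half[OF assms] by simp
    then have "riesz_product l n M x * (1 / 2) ^ r \<le> riesz_product l n (M + r) x"
      unfolding riesz_product_split
      using riesz_product_pos[OF assms, of n M x] by (intro mult_left_mono) auto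
    then show ?thesis by (simp add: power_one_over field_simps)
  qed
  then have "integral {0..1} (riesz_product l n M) \<le>
      integral {0..1} (\<lambda>x. 2 ^ r * riesz_product l n (M + r) x)"
    by (intro integral_le integrable_continuous_real continuous_intros) auto
  then show ?thesis by simp
qed

lemma abs_integral_weighted_le:
  fixes f g :: "real \<Rightarrow> real"
  assumes "continuous_on {0..1} f" "continuous_on {0..1} g"
    and "\<And>x. f x \<ge> 0" "\<And>x. \<bar>g x\<bar> \<le> K"
  shows "\<bar>integral {0..1} (\<lambda>x. f x * g x)\<bar> \<le> K * integral {0..1} f"
proof -
  have "\<bar>integral {0..1} (\<lambda>x. f x * g x)\<bar> \<le> integral {0..1} (\<lambda>x. K * f x)"
    unfolding real_norm_def[symmetric]
    using assms by (intro integral_norm_bound_integral integrable_continuous_real continuous_intros)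
      (auto simp: abs_mult mult.commute[of K] intro: mult_left_mono)
  then show ?thesis by simp
qed

text \<open>The last \<open>r\<close> factors are expanded around 1. The hypotheses
  \<open>gap\<close> and \<open>gap0\<close> place the degrees of the truncated product, with and
  without one extra cosine, below \<open>m\<close>, so only the remainder of the expansion
  correlates. Nonnegativity of the truncated product then yields a bound by its own mean
  \<open>E\<close>.\<close>

lemma riesz_product_correlations:
  fixes n :: "nat \<Rightarrow> nat"
  assumes l: "\<bar>l\<bar> \<le> 1 / 4"
    and gap: "\<And>j. j < r \<Longrightarrow> (\<Sum>k=1..M. 2 * n k) + n (Suc (M + j)) < m"
    and gap0: "(\<Sum>k=1..M. 2 * n k) < m"
  defines "E \<equiv> integral {0..1} (riesz_product l n M)"
  shows "\<bar>integral {0..1} (\<lambda>x. riesz_product l n (M + r) x * cos (2 * pi * real m * x))\<bar> \<le> 7 ^ r * l\<^sup>2 * E"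
    and "\<bar>integral {0..1} (\<lambda>x. riesz_product l n (M + r) x * cos (2 * pi * real (2 * m) * x))\<bar>
           \<le> 3 * 7 ^ r * \<bar>l\<bar> * E"
proof -
  let ?F = "riesz_product l n M"
  define a where "a k x = sqrt 2 * cos (2 * pi * real (n (Suc (M + k))) * x)" for k x
  define Q where "Q x = (\<Prod>k<r. riesz_factor l (n (Suc (M + k))) x)" for x
  define R where "R x = Q x - 1 - l * (\<Sum>k<r. a k x)" for x
  note [continuous_intros] = continuous_on_riesz_product[of "{0..1}"]
  have [continuous_intros]: "continuous_on {0..1} (a k)" for k
    unfolding a_def by (intro continuous_intros)
  have [continuous_intros]: "continuous_on {0..1} Q"
    unfolding Q_def by (intro continuous_intros)
  have [continuous_intros]: "continuous_on {0..1} R"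
    unfolding R_def by (intro continuous_intros)
  have a: "\<bar>a k x\<bar> \<le> 2" for k x
    using abs_sqrt2_cos_le[of "2 * pi * real (n (Suc (M + k))) * x"] by (simp add: a_def)
  have R: "\<bar>R x\<bar> \<le> 7 ^ r * l\<^sup>2" for x
    unfolding R_def Q_def riesz_factor_def a_def[symmetric]
    using l a by (intro prod_second_order_bound) auto
  have F: "?F x \<ge> 0" for x using riesz_product_pos[OF l] by (simp add: less_imp_le)
  have first_order: "integral {0..1} (\<lambda>x. ?F x * a k x * cos (2 * pi * real m * x)) = 0" if "k < r" for k
    unfolding a_def
    by (rule integral_cos_poly_mult_cos[OF cos_poly_mult_cos[OF cos_poly_riesz_product] gap[OF that]])

  have eq1: "(\<lambda>x. riesz_product l n (M + r) x * cos (2 * pi * real m * x)) =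
     (\<lambda>x. ?F x * cos (2 * pi * real m * x) + l * (\<Sum>k<r. ?F x * a k x * cos (2 * pi * real m * x))
        + ?F x * (R x * cos (2 * pi * real m * x)))"
    unfolding riesz_product_split Q_def[symmetric] R_def
    by (simp add: fun_eq_iff algebra_simps sum_distrib_left sum_distrib_right)
  have eq2: "integral {0..1} \<dots> =
      integral {0..1} (\<lambda>x. ?F x * cos (2 * pi * real m * x))
      + l * (\<Sum>k<r. integral {0..1} (\<lambda>x. ?F x * a k x * cos (2 * pi * real m * x)))
      + integral {0..1} (\<lambda>x. ?F x * (R x * cos (2 * pi * real m * x)))"
    by (intro integral_unique has_integral_add has_integral_mult_right has_integral_sum
        integrable_integral integrable_continuous_real continuous_intros finite_lessThan)
  have eq3: "\<dots> = integral {0..1} (\<lambda>x. ?F x * (R x * cos (2 * pi * real m * x)))"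
    using first_order integral_cos_poly_mult_cos[OF cos_poly_riesz_product gap0] by simp
  have "integral {0..1} (\<lambda>x. riesz_product l n (M + r) x * cos (2 * pi * real m * x))
      = integral {0..1} (\<lambda>x. ?F x * (R x * cos (2 * pi * real m * x)))"
    by (simp only: eq1 eq2 eq3)
  also have "\<bar>\<dots>\<bar> \<le> 7 ^ r * l\<^sup>2 * E"
    unfolding E_def
  proof (intro abs_integral_weighted_le continuous_intros F)
    show "\<bar>R x * cos (2 * pi * real m * x)\<bar> \<le> 7 ^ r * l\<^sup>2" for x
      using mult_mono[OF R abs_cos_le_one[of "2 * pi * real m * x"]] by (simp add: abs_mult)
  qed
  finally show "\<bar>integral {0..1} (\<lambda>x. riesz_product l n (M + r) x * cos (2 * pi * real m * x))\<bar>
      \<le> 7 ^ r * l\<^sup>2 * E" .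

  \<comment> \<open>For frequency \<open>2 * m\<close> the factor \<open>l\<^sup>2\<close> in front
    allows a cruder bound: the linear term gives \<open>2 * 7 ^ r\<close>, the quadratic remainder
    another \<open>7 ^ r\<close> since \<open>l\<^sup>2 \<le> \<bar>l\<bar>\<close>.\<close>
  have Q: "\<bar>Q x - 1\<bar> \<le> 3 * 7 ^ r * \<bar>l\<bar>" for x
  proof -
    have "\<bar>\<Sum>k<r. a k x\<bar> \<le> 2 * real r"
      using sum_norm_le[of "{..<r}" "\<lambda>k. a k x" "\<lambda>_. 2"] a by (simp add: mult_ac)
    also have "\<dots> \<le> 2 * 7 ^ r"
      using Bernoulli_inequality[of "6 :: real" r] by simp
    finally have "\<bar>l * (\<Sum>k<r. a k x)\<bar> \<le> 2 * (7 ^ r * \<bar>l\<bar>)"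
      using mult_left_mono[of _ _ "\<bar>l\<bar>"] by (fastforce simp: abs_mult mult_ac)
    moreover have "\<bar>l\<bar> * \<bar>l\<bar> \<le> \<bar>l\<bar> * 1"
      using l by (intro mult_left_mono) auto
    then have "7 ^ r * l\<^sup>2 \<le> 7 ^ r * \<bar>l\<bar>"
      by (simp add: power2_eq_square)
    moreover have "Q x - 1 = l * (\<Sum>k<r. a k x) + R x" by (simp add: R_def)
    ultimately show ?thesis using R[of x] by (simp only: mult.assoc)
  qed
  have "(\<lambda>x. riesz_product l n (M + r) x * cos (2 * pi * real (2 * m) * x)) =
     (\<lambda>x. ?F x * cos (2 * pi * real (2 * m) * x) + ?F x * ((Q x - 1) * cos (2 * pi * real (2 * m) * x)))"
    unfolding riesz_product_split Q_def[symmetric] by (simp add: fun_eq_iff algebra_simps)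
  moreover have "integral {0..1} \<dots> =
      integral {0..1} (\<lambda>x. ?F x * cos (2 * pi * real (2 * m) * x))
      + integral {0..1} (\<lambda>x. ?F x * ((Q x - 1) * cos (2 * pi * real (2 * m) * x)))"
    by (intro integral_add integrable_continuous_real continuous_intros)
  moreover have "integral {0..1} (\<lambda>x. ?F x * cos (2 * pi * real (2 * m) * x)) = 0"
    using gap0 by (intro integral_cos_poly_mult_cos[OF cos_poly_riesz_product]) auto
  ultimately have "integral {0..1} (\<lambda>x. riesz_product l n (M + r) x * cos (2 * pi * real (2 * m) * x))
      = integral {0..1} (\<lambda>x. ?F x * ((Q x - 1) * cos (2 * pi * real (2 * m) * x)))" by simp
  also have "\<bar>\<dots>\<bar> \<le> 3 * 7 ^ r * \<bar>l\<bar> * E"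
    unfolding E_def
  proof (intro abs_integral_weighted_le continuous_intros F)
    show "\<bar>(Q x - 1) * cos (2 * pi * real (2 * m) * x)\<bar> \<le> 3 * 7 ^ r * \<bar>l\<bar>" for x
      using mult_mono[OF Q abs_cos_le_one[of "2 * pi * real (2 * m) * x"]] by (simp add: abs_mult)
  qed
  finally show "\<bar>integral {0..1} (\<lambda>x. riesz_product l n (M + r) x * cos (2 * pi * real (2 * m) * x))\<bar>
      \<le> 3 * 7 ^ r * \<bar>l\<bar> * E" .
qed

text \<open>With \<open>u\<close> the relative error, the logarithm of \<open>1 + u\<close> is
  \<open>u\<close> up to \<open>2 * u\<^sup>2\<close>, which is at most
  \<open>\<bar>u\<bar>\<close>.\<close>

lemma abs_ln_le_of_close:
  fixes a b t :: real
  assumes "a > 0" "\<bar>b - a\<bar> \<le> t * a" "t \<le> 1 / 2"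
  shows "\<bar>ln b - ln a\<bar> \<le> 2 * t"
proof -
  define u where "u = (b - a) / a"
  have u: "\<bar>u\<bar> \<le> t" using assms(1,2) by (simp add: u_def abs_divide divide_le_eq)
  have "\<bar>ln (1 + u) - u\<bar> \<le> 2 * u\<^sup>2"
    using u assms(3) by (intro abs_ln_one_plus_x_minus_x_bound) auto
  moreover have "2 * u\<^sup>2 \<le> \<bar>u\<bar>"
  proof -
    have "\<bar>u\<bar> * (2 * \<bar>u\<bar>) \<le> \<bar>u\<bar> * 1" using u assms(3) by (intro mult_left_mono) auto
    then show ?thesis by (simp add: power2_eq_square)
  qed
  moreover have "b = a * (1 + u)" using assms(1) by (simp add: u_def field_simps)
  then have "ln b = ln a + ln (1 + u)"
    using assms(1) u assms(3) by (simp add: ln_mult_pos)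
  ultimately show ?thesis using u by linarith
qed

text \<open>Each new factor changes the logarithm of the mean by at most
  \<open>6 * 14 ^ r * \<bar>l\<bar> ^ 3\<close>. Here 14 is 7 from the correlation bound times 2
  from returning to the full mean; 6 is 3/2 from each of the two frequencies, doubled on taking
  logarithms.\<close>

lemma abs_ln_integral_riesz_product_le:
  fixes n :: "nat \<Rightarrow> nat"
  assumes l: "\<bar>l\<bar> \<le> 1 / 4" and small: "3 * 14 ^ r * \<bar>l\<bar> ^ 3 \<le> 1 / 2"
    and gap: "\<And>N j. j \<in> {Suc (N - r)..N} \<Longrightarrow> (\<Sum>k=1..N - r. 2 * n k) + n j < n (Suc N)"
    and gap0: "\<And>N. (\<Sum>k=1..N - r. 2 * n k) < n (Suc N)"
  shows "\<bar>ln (integral {0..1} (riesz_product l n N))\<bar> \<le> 6 * 14 ^ r * \<bar>l\<bar> ^ 3 * real N"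
proof (induction N)
  case (Suc N)
  let ?E = "\<lambda>N. integral {0..1} (riesz_product l n N)"
  let ?c = "\<lambda>m. integral {0..1} (\<lambda>x. riesz_product l n N x * cos (2 * pi * real m * x))"
  \<comment> \<open>Truncated subtraction covers \<open>N < r\<close>: then \<open>M = 0\<close> and
    all \<open>s = N\<close> factors are split off.\<close>
  define M where "M = N - r"
  define s where "s = N - M"
  have N: "N = M + s" and s: "s \<le> r" by (auto simp: M_def s_def)
  have E: "?E N > 0" "?E M > 0" by (rule integral_riesz_product_pos[OF l])+
  have gap': "(\<Sum>k=1..M. 2 * n k) + n (Suc (M + j)) < n (Suc N)" if "j < s" for j
    unfolding M_def using that by (intro gap) (auto simp: s_def M_def)
  have gap0': "(\<Sum>k=1..M. 2 * n k) < n (Suc N)"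
    unfolding M_def by (rule gap0)
  have c1: "\<bar>?c (n (Suc N))\<bar> \<le> 7 ^ s * l\<^sup>2 * ?E M"
    using riesz_product_correlations(1)[OF l gap' gap0'] unfolding N by simp
  have c2: "\<bar>?c (2 * n (Suc N))\<bar> \<le> 3 * 7 ^ s * \<bar>l\<bar> * ?E M"
    using riesz_product_correlations(2)[OF l gap' gap0'] unfolding N by simp
  have "riesz_product l n (Suc N) = (\<lambda>x. riesz_product l n N x
      + (l * sqrt 2) * (riesz_product l n N x * cos (2 * pi * real (n (Suc N)) * x))
      + (l\<^sup>2 / 2) * (riesz_product l n N x * cos (2 * pi * real (2 * n (Suc N)) * x)))"
    by (simp add: fun_eq_iff riesz_product_Suc riesz_factor_def algebra_simps)
  moreover have "integral {0..1} \<dots> =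
      ?E N + (l * sqrt 2) * ?c (n (Suc N)) + (l\<^sup>2 / 2) * ?c (2 * n (Suc N))"
    by (intro integral_unique has_integral_add has_integral_mult_right
        integrable_integral integrable_continuous_real continuous_intros)
  ultimately have "?E (Suc N) - ?E N = (l * sqrt 2) * ?c (n (Suc N)) + (l\<^sup>2 / 2) * ?c (2 * n (Suc N))"
    by simp
  then have "\<bar>?E (Suc N) - ?E N\<bar> \<le> \<bar>(l * sqrt 2) * ?c (n (Suc N))\<bar> + \<bar>(l\<^sup>2 / 2) * ?c (2 * n (Suc N))\<bar>"
    by (simp only: abs_triangle_ineq)
  also have "\<dots> \<le> \<bar>l\<bar> * (3 / 2) * (7 ^ s * l\<^sup>2 * ?E M) + (l\<^sup>2 / 2) * (3 * 7 ^ s * \<bar>l\<bar> * ?E M)"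
  proof (rule add_mono)
    have "\<bar>l * sqrt 2\<bar> \<le> \<bar>l\<bar> * (3 / 2)"
      unfolding abs_mult using abs_sqrt2_cos_le[of 0] by (intro mult_left_mono) auto
    then show "\<bar>(l * sqrt 2) * ?c (n (Suc N))\<bar> \<le> \<bar>l\<bar> * (3 / 2) * (7 ^ s * l\<^sup>2 * ?E M)"
      unfolding abs_mult[of "l * sqrt 2"] by (rule mult_mono[OF _ c1]) simp_all
    show "\<bar>(l\<^sup>2 / 2) * ?c (2 * n (Suc N))\<bar> \<le> (l\<^sup>2 / 2) * (3 * 7 ^ s * \<bar>l\<bar> * ?E M)"
      unfolding abs_mult[of "l\<^sup>2 / 2"] by (rule mult_mono[OF _ c2]) simp_all
  qed
  also have "\<dots> = 3 * 7 ^ s * \<bar>l\<bar> ^ 3 * ?E M"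
    by (simp add: power2_abs[of l, symmetric] power2_eq_square[of "\<bar>l\<bar>"] power3_eq_cube
        del: power2_abs abs_mult_self_eq)
  also have "\<dots> \<le> 3 * 7 ^ s * \<bar>l\<bar> ^ 3 * (2 ^ s * ?E N)"
    unfolding N by (intro mult_left_mono integral_riesz_product_split_le l) auto
  also have "\<dots> = 3 * 14 ^ s * \<bar>l\<bar> ^ 3 * ?E N"
    by (simp flip: power_mult_distrib)
  also have "\<dots> \<le> 3 * 14 ^ r * \<bar>l\<bar> ^ 3 * ?E N"
    using E s by (intro mult_right_mono mult_left_mono power_increasing) auto
  finally have "\<bar>ln (?E (Suc N)) - ln (?E N)\<bar> \<le> 2 * (3 * 14 ^ r * \<bar>l\<bar> ^ 3)"
    using E small by (intro abs_ln_le_of_close)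
  then have "\<bar>ln (?E (Suc N))\<bar> \<le> 6 * 14 ^ r * \<bar>l\<bar> ^ 3 + 6 * 14 ^ r * \<bar>l\<bar> ^ 3 * real N"
    using Suc.IH by linarith
  then show ?case by (simp add: algebra_simps)
qed simp

subsection \<open>Comparison with the exponential\<close>

text \<open>The factor is the Taylor expansion of \<open>exp (l * c - l\<^sup>2 / 2)\<close> to
  second order in \<open>l\<close>. The errors 8/3, 3/4 and 1/32 total less than 4; dividing by a
  factor at least 1/2 and taking logarithms each cost a 2, giving 16.\<close>

lemma abs_ln_riesz_factor_le:
  assumes l: "\<bar>l\<bar> \<le> 1 / 4" and c: "c = sqrt 2 * cos (2 * pi * real m * x)"
  shows "\<bar>(l * c - l\<^sup>2 / 2) - ln (riesz_factor l m x)\<bar> \<le> 16 * \<bar>l\<bar> ^ 3"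
proof -
  define y where "y = l * c - l\<^sup>2 / 2"
  let ?P = "riesz_factor l m x"
  have c2: "\<bar>c\<bar> \<le> 3 / 2" unfolding c by (rule abs_sqrt2_cos_le)
  have lc: "\<bar>l * c\<bar> \<le> \<bar>l\<bar> * (3 / 2)" unfolding abs_mult using c2 by (intro mult_left_mono) auto
  have "l\<^sup>2 \<le> \<bar>l\<bar> * (1 / 4)"
    using mult_left_mono[OF l, of "\<bar>l\<bar>"] by (simp add: power2_eq_square)
  then have y: "\<bar>y\<bar> \<le> 2 * \<bar>l\<bar>" unfolding y_def using lc zero_le_power2[of l] by linarith
  have l3: "\<bar>l\<bar> ^ 3 \<le> 1 / 64" using power_mono[OF l abs_ge_zero, of 3] by (simp add: power3_eq_cube)
  obtain t where t: "\<bar>t\<bar> \<le> \<bar>y\<bar>" "exp y = (\<Sum>i<3. y ^ i / fact i) + (exp t / fact 3) * y ^ 3"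
    using Maclaurin_exp_le[of y 3] by blast
  have "exp t \<le> 2" using exp_bound_half[of t] t(1) y l by simp
  have "exp y - (1 + y + y\<^sup>2 / 2) = (exp t / 6) * y ^ 3"
    unfolding t(2) by (simp add: eval_nat_numeral)
  also have "\<bar>\<dots>\<bar> \<le> (2 / 6) * (2 * \<bar>l\<bar>) ^ 3"
    unfolding abs_mult power_abs using y \<open>exp t \<le> 2\<close> by (intro mult_mono power_mono) auto
  finally have e: "\<bar>exp y - (1 + y + y\<^sup>2 / 2)\<bar> \<le> 8 / 3 * \<bar>l\<bar> ^ 3"
    by (simp add: power_mult_distrib)
  \<comment> \<open>The square of \<open>y\<close> supplies the missing
    \<open>l\<^sup>2 * c\<^sup>2 / 2\<close>; its other terms are already of order at least three in
    \<open>l\<close>.\<close>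
  have p: "1 + y + y\<^sup>2 / 2 - ?P = - (l ^ 3 * (c / 2)) + l ^ 3 * (l / 8)"
    unfolding riesz_factor_eq[OF c] y_def by (simp add: power2_eq_square power3_eq_cube field_simps)
  have "\<bar>l ^ 3 * (c / 2)\<bar> \<le> \<bar>l\<bar> ^ 3 * (3 / 4)"
    unfolding abs_mult power_abs using c2 by (intro mult_left_mono) auto
  moreover have "\<bar>l ^ 3 * (l / 8)\<bar> \<le> \<bar>l\<bar> ^ 3 * (1 / 32)"
    unfolding abs_mult power_abs using l by (intro mult_left_mono) auto
  ultimately have "\<bar>exp y - ?P\<bar> \<le> 4 * \<bar>l\<bar> ^ 3"
    using e p by linarith
  also have "\<dots> \<le> 8 * \<bar>l\<bar> ^ 3 * ?P"
    using mult_left_mono[OF riesz_factor_ge_half[OF l], of "8 * \<bar>l\<bar> ^ 3" m x] by simp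
  finally have "\<bar>ln (exp y) - ln ?P\<bar> \<le> 2 * (8 * \<bar>l\<bar> ^ 3)"
    using riesz_factor_ge_half[OF l, of m x] l3 by (intro abs_ln_le_of_close) auto
  then show ?thesis by (simp add: y_def)
qed

text \<open>The quotient of \<open>f\<close> and \<open>g\<close> lies between
  \<open>exp (- K)\<close> and \<open>exp K\<close> pointwise, and these bounds survive
  integration.\<close>

lemma abs_ln_integral_diff_le:
  fixes f g :: "real \<Rightarrow> real"
  assumes cont: "continuous_on {0..1} f" "continuous_on {0..1} g"
    and pos: "\<And>x. f x > 0" "\<And>x. g x > 0" "integral {0..1} g > 0"
    and close: "\<And>x. \<bar>ln (f x) - ln (g x)\<bar> \<le> K"
  shows "\<bar>ln (integral {0..1} f) - ln (integral {0..1} g)\<bar> \<le> K"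
proof -
  let ?I = "integral {0..1}"
  have bound: "f x \<le> exp K * g x" "exp (- K) * g x \<le> f x" for x
  proof -
    have "exp (ln (f x)) \<le> exp (K + ln (g x))" "exp (- K + ln (g x)) \<le> exp (ln (f x))"
      using close[of x] by auto
    then show "f x \<le> exp K * g x" "exp (- K) * g x \<le> f x"
      using pos(1,2)[of x] unfolding exp_add by simp_all
  qed
  have "?I f \<le> ?I (\<lambda>x. exp K * g x)"
    using bound cont by (intro integral_le integrable_continuous_real continuous_intros) auto
  moreover have "?I (\<lambda>x. exp (- K) * g x) \<le> ?I f"
    using bound cont by (intro integral_le integrable_continuous_real continuous_intros) auto
  ultimately have u: "?I f \<le> exp K * ?I g" and lo: "exp (- K) * ?I g \<le> ?I f" by simp_all
  have "exp (- K) * ?I g > 0" using pos(3) by simp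
  then have If: "?I f > 0" using lo by linarith
  have "ln (?I f) \<le> ln (exp K * ?I g)" using u If pos(3) by (subst ln_le_cancel_iff) auto
  moreover have "ln (exp (- K) * ?I g) \<le> ln (?I f)" using lo If pos(3) by (subst ln_le_cancel_iff) auto
  ultimately show ?thesis using pos(3) by (simp add: ln_mult abs_le_iff)
qed

subsection \<open>Lacunary sequences\<close>

lemma lacunary_power_le:
  fixes n :: "nat \<Rightarrow> nat" and q :: real
  assumes "q > 1" and lac: "\<And>k. k \<ge> 1 \<Longrightarrow> q * n k \<le> n (Suc k)" and "k \<ge> 1"
  shows "q ^ i * n k \<le> n (k + i)"
proof (induction i)
  case (Suc i)
  have "q ^ Suc i * n k = q * (q ^ i * n k)" by simp
  also have "\<dots> \<le> q * n (k + i)" using Suc assms(1) by (intro mult_left_mono) auto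
  also have "\<dots> \<le> n (Suc (k + i))" using assms(3) by (intro lac) auto
  finally show ?case by simp
qed simp

text \<open>Telescoping: lacunarity says that \<open>(q - 1) * n k\<close> is at most the increment
  from \<open>n k\<close> to \<open>n (Suc k)\<close>.\<close>

lemma lacunary_sum_le:
  fixes n :: "nat \<Rightarrow> nat" and q :: real
  assumes lac: "\<And>k. k \<ge> 1 \<Longrightarrow> q * n k \<le> n (Suc k)"
  shows "(q - 1) * (\<Sum>k=1..M. n k) \<le> n (Suc M)"
proof (induction M)
  case (Suc M)
  then show ?case using lac[of "Suc M"] by (simp add: algebra_simps)
qed simp

text \<open>Since \<open>n j\<close> takes at most the fraction \<open>1 / q\<close> of
  \<open>n (Suc N)\<close>, the doubled sum must fit into the remaining \<open>(q - 1) / q\<close>.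
  Geometric growth over \<open>r\<close> steps makes the sum at most
  \<open>n (Suc N) / (q ^ r * (q - 1))\<close>, which dictates the choice of \<open>r\<close> from
  \<open>q\<close> alone.\<close>

lemma lacunary_gap:
  fixes q :: real
  assumes q: "q > 1"
  obtains r :: nat where
    "\<And>(n :: nat \<Rightarrow> nat) N j. (\<And>k. k \<ge> 1 \<Longrightarrow> n k > 0) \<Longrightarrow> (\<And>k. k \<ge> 1 \<Longrightarrow> q * n k \<le> n (Suc k)) \<Longrightarrow>
       j \<in> {1..N} \<Longrightarrow> ((\<Sum>k=1..N - r. 2 * n k) + n j :: nat) < n (Suc N)"
proof -
  obtain r where r: "2 * q / (q - 1)\<^sup>2 < q ^ r" using real_arch_pow[OF q] by blast
  have "((\<Sum>k=1..N - r. 2 * n k) + n j :: nat) < n (Suc N)"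
    if pos: "\<And>k. k \<ge> 1 \<Longrightarrow> n k > 0" and lac: "\<And>k. k \<ge> 1 \<Longrightarrow> q * n k \<le> n (Suc k)"
      and j: "j \<in> {1..N}" for n :: "nat \<Rightarrow> nat" and N j
  proof -
    define S where "S = (\<Sum>k=1..N - r. n k)"
    let ?m = "real (n (Suc N))"
    have m: "?m > 0" using pos by simp
    have "q ^ 1 * n j \<le> q ^ (Suc N - j) * n j"
      using q j by (intro mult_right_mono power_increasing) auto
    also have "\<dots> \<le> n (j + (Suc N - j))" using j by (intro lacunary_power_le[of q n, OF q lac]) auto
    finally have nj: "q * n j \<le> ?m" using j by simp
    have "q * (2 * S) < (q - 1) * ?m"
    proof (cases "r \<le> N")
      case True
      have "q ^ r * ((q - 1) * S) \<le> q ^ r * n (Suc (N - r))"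
        unfolding S_def using q by (intro mult_left_mono lacunary_sum_le lac) auto
      also have "\<dots> \<le> n (Suc (N - r) + r)" by (rule lacunary_power_le[of q n, OF q lac]) auto
      finally have *: "q ^ r * ((q - 1) * S) \<le> ?m" using True by simp
      have "2 * q < q ^ r * (q - 1)\<^sup>2" using r q by (simp add: divide_less_eq)
      show ?thesis
      \<comment> \<open>Multiplying the strict inequality by \<open>S\<close> needs \<open>S\<close>
        positive; for \<open>S = 0\<close> positivity of \<open>n (Suc N)\<close> suffices. If
        \<open>r > N\<close>, the sum is empty.\<close>
      proof (cases "S = 0")
        case False
        then have "2 * q * S < q ^ r * (q - 1)\<^sup>2 * S"
          using \<open>2 * q < _\<close> by (intro mult_strict_right_mono) auto
        also have "\<dots> = (q - 1) * (q ^ r * ((q - 1) * S))" by (simp add: power2_eq_square)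
        also have "\<dots> \<le> (q - 1) * ?m" using * q by (intro mult_left_mono) auto
        finally show ?thesis by simp
      qed (use q m in simp)
    qed (use q m in \<open>simp add: S_def\<close>)
    then have "q * (2 * S + n j) < q * ?m" using nj by (simp add: algebra_simps)
    then have "2 * S + n j < n (Suc N)" using q by (simp flip: of_nat_add of_nat_mult)
    then show ?thesis by (simp add: S_def sum_distrib_left)
  qed
  then show thesis by (rule that)
qed

section \<open>The Lebesgue integral and the final estimate\<close>

lemma set_lborel_integral_open_unit:
  fixes f :: "real \<Rightarrow> real"
  assumes "continuous_on {0..1} f"
  shows "(LINT x:{0<..<1}|lborel. f x) = integral {0..1} f"
proof -
  have "set_integrable lborel {0..1} f"
    using assms by (rule borel_integrable_atLeastAtMost')
  then have "set_integrable lborel {0<..<1} f"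
    by (rule set_integrable_subset) auto
  then show ?thesis
    by (simp add: set_borel_integral_eq_integral(2) integral_open_interval_real)
qed

theorem theorem1:
  fixes q :: real
  assumes "q > 1"
  shows "\<exists>C>0. \<forall>n :: nat \<Rightarrow> nat.
           ((\<forall>k\<ge>1. n k > 0) \<and> (\<forall>k\<ge>1. real (n (Suc k)) / real (n k) \<ge> q)) \<longrightarrow>
           (\<exists>N0. \<forall>N\<ge>N0. \<forall>l::real. l \<in> {-1..1} \<longrightarrow>
              \<bar>ln (LINT x:{0<..<1}|lborel. exp (l * (\<Sum>k=1..N. sqrt 2 * cos (2 * pi * real (n k) * x))))
                 - l\<^sup>2 * real N / 2\<bar> \<le> C * \<bar>l\<bar> ^ 3 * real N)"
proof -
  obtain r where r: "\<And>(n :: nat \<Rightarrow> nat) N j. (\<And>k. k \<ge> 1 \<Longrightarrow> n k > 0) \<Longrightarrow>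
      (\<And>k. k \<ge> 1 \<Longrightarrow> q * n k \<le> n (Suc k)) \<Longrightarrow>
      j \<in> {1..N} \<Longrightarrow> ((\<Sum>k=1..N - r. 2 * n k) + n j :: nat) < n (Suc N)"
    using lacunary_gap[OF assms] by blast
  define A :: real where "A = 3 * 14 ^ r"
  have A: "A > 0" by (simp add: A_def)
  have main: "\<bar>ln (LINT x:{0<..<1}|lborel. exp (l * (\<Sum>k=1..N. sqrt 2 * cos (2 * pi * real (n k) * x))))
      - l\<^sup>2 * real N / 2\<bar> \<le> (140 + 6 * A) * \<bar>l\<bar> ^ 3 * real N"
    if pos: "\<And>k. k \<ge> 1 \<Longrightarrow> n k > 0" and lac: "\<And>k. k \<ge> 1 \<Longrightarrow> real (n (Suc k)) / real (n k) \<ge> q"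
      and l: "\<bar>l\<bar> \<le> 1"
    for n :: "nat \<Rightarrow> nat" and l N
  proof -
    let ?I = "integral {0..1}"
    define c where "c k x = sqrt 2 * cos (2 * pi * real (n k) * x)" for k x
    define G where "G x = exp (l * (\<Sum>k=1..N. c k x))" for x
    have contG: "continuous_on {0..1} G"
      unfolding G_def c_def by (intro continuous_intros)
    have c: "\<bar>c k x\<bar> \<le> 3 / 2" for k x unfolding c_def by (rule abs_sqrt2_cos_le)
    have lac': "q * n k \<le> n (Suc k)" if "k \<ge> 1" for k
      using lac[OF that] pos[OF that] by (simp add: le_divide_eq)
    have "\<bar>ln (?I G) - l\<^sup>2 * real N / 2\<bar> \<le> (140 + 6 * A) * \<bar>l\<bar> ^ 3 * real N"
    \<comment> \<open>Both smallness conditions depend only on \<open>q\<close> through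
      \<open>A\<close>. If either fails, \<open>\<bar>l\<bar> ^ 3\<close> is bounded below and an
      error linear in \<open>N\<close> is acceptable.\<close>
    proof (cases "\<bar>l\<bar> \<le> 1 / 4 \<and> A * \<bar>l\<bar> ^ 3 \<le> 1 / 2")
      case True
      then have l4: "\<bar>l\<bar> \<le> 1 / 4" by simp
      \<comment> \<open>Restoring the factor \<open>exp (l\<^sup>2 / 2)\<close> for each
        \<open>k\<close> makes \<open>H\<close> comparable with \<open>G\<close> factor by
        factor.\<close>
      define H where "H x = exp (l\<^sup>2 * real N / 2) * riesz_product l n N x" for x
      have IH: "?I H = exp (l\<^sup>2 * real N / 2) * ?I (riesz_product l n N)"
        unfolding H_def by simp
      have "\<bar>ln (G x) - ln (H x)\<bar> \<le> 16 * \<bar>l\<bar> ^ 3 * real N" for x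
      proof -
        have "ln (riesz_product l n N x) = (\<Sum>k=1..N. ln (riesz_factor l (n k) x))"
          unfolding riesz_product_def
        proof (rule ln_prod)
          show "riesz_factor l (n k) x \<noteq> 0" for k
            using riesz_factor_ge_half[OF l4, of "n k" x] by auto
        qed simp
        then have "ln (G x) - ln (H x) = (\<Sum>k=1..N. (l * c k x - l\<^sup>2 / 2) - ln (riesz_factor l (n k) x))"
          using riesz_product_pos[OF l4, of n N x]
          by (simp add: G_def H_def ln_mult sum_subtractf sum_distrib_left)
        also have "\<bar>\<dots>\<bar> \<le> (\<Sum>k=1..N. 16 * \<bar>l\<bar> ^ 3)"
          by (intro order_trans[OF sum_abs] sum_mono abs_ln_riesz_factor_le l4 c_def)
        finally show ?thesis by (simp add: mult_ac)
      qed
      then have "\<bar>ln (?I G) - ln (?I H)\<bar> \<le> 16 * \<bar>l\<bar> ^ 3 * real N"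
        using contG riesz_product_pos[OF l4] integral_riesz_product_pos[OF l4]
        by (intro abs_ln_integral_diff_le)
           (auto simp: G_def IH, auto simp: H_def intro!: continuous_intros)
      moreover have "ln (?I H) = l\<^sup>2 * real N / 2 + ln (?I (riesz_product l n N))"
        using integral_riesz_product_pos[OF l4, of n N] by (simp add: IH ln_mult)
      moreover have "\<bar>ln (?I (riesz_product l n N))\<bar> \<le> 6 * 14 ^ r * \<bar>l\<bar> ^ 3 * real N"
      proof (rule abs_ln_integral_riesz_product_le[OF l4])
        show "3 * 14 ^ r * \<bar>l\<bar> ^ 3 \<le> 1 / 2" using True by (simp add: A_def)
        show "(\<Sum>k=1..N - r. 2 * n k) + n j < n (Suc N)" if "j \<in> {Suc (N - r)..N}" for N j
          using that by (intro r pos lac') auto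
        \<comment> \<open>For \<open>N > 0\<close> drop the extra term from the gap at
          \<open>j = N\<close>; for \<open>N = 0\<close> no such \<open>j\<close> exists, but the
          sum is empty.\<close>
        show "(\<Sum>k=1..N - r. 2 * n k) < n (Suc N)" for N
          using r[of n N N, OF pos lac'] pos[of "Suc 0"] by (cases "N = 0") auto
      qed
      ultimately have "\<bar>ln (?I G) - l\<^sup>2 * real N / 2\<bar> \<le> 16 * \<bar>l\<bar> ^ 3 * real N + 2 * A * \<bar>l\<bar> ^ 3 * real N"
        unfolding A_def by simp
      also have "\<dots> = (16 + 2 * A) * (\<bar>l\<bar> ^ 3 * real N)" by (simp add: algebra_simps)
      also have "\<dots> \<le> (140 + 6 * A) * (\<bar>l\<bar> ^ 3 * real N)"
        using A by (intro mult_right_mono) auto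
      finally show ?thesis by (simp add: mult_ac)
    next
      case False
      have "\<bar>ln (G x) - ln 1\<bar> \<le> 3 / 2 * real N" for x
      proof -
        have "\<bar>\<Sum>k=1..N. c k x\<bar> \<le> (\<Sum>k=1..N. 3 / 2)"
          by (intro order_trans[OF sum_abs] sum_mono c)
        then have "\<bar>l\<bar> * \<bar>\<Sum>k=1..N. c k x\<bar> \<le> 1 * (\<Sum>k=1..N. 3 / 2)"
          using l by (intro mult_mono) auto
        then show ?thesis by (simp add: G_def abs_mult mult_ac)
      qed
      then have "\<bar>ln (?I G) - ln (?I (\<lambda>x::real. 1::real))\<bar> \<le> 3 / 2 * real N"
        using contG by (intro abs_ln_integral_diff_le) (auto simp: G_def)
      moreover have "\<bar>l\<^sup>2 * real N / 2\<bar> \<le> 1 / 2 * real N"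
        using l mult_right_mono[of "l\<^sup>2" 1 "real N"] by (simp add: abs_square_le_1)
      moreover have "ln (?I (\<lambda>x::real. 1::real)) = 0" by simp
      ultimately have "\<bar>ln (?I G) - l\<^sup>2 * real N / 2\<bar> \<le> 2 * real N" by linarith
      also have "2 \<le> (140 + 6 * A) * \<bar>l\<bar> ^ 3"
      proof -
        \<comment> \<open>This fixes the constants: \<open>140 / 64 > 2\<close> handles the first
          alternative, and \<open>6 * (1 / 2) > 2\<close> the second.\<close>
        have "1 / 64 \<le> \<bar>l\<bar> ^ 3 \<or> 1 / 2 \<le> A * \<bar>l\<bar> ^ 3"
          using False power_mono[of "1 / 4" "\<bar>l\<bar>" 3] by (auto simp: power3_eq_cube)
        moreover have "0 \<le> \<bar>l\<bar> ^ 3" "0 \<le> A * \<bar>l\<bar> ^ 3" using A by auto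
        ultimately have "2 \<le> 140 * \<bar>l\<bar> ^ 3 + 6 * (A * \<bar>l\<bar> ^ 3)" by linarith
        then show ?thesis by (simp add: algebra_simps)
      qed
      then have "2 * real N \<le> (140 + 6 * A) * \<bar>l\<bar> ^ 3 * real N" by (intro mult_right_mono) auto
      finally show ?thesis .
    qed
    then show ?thesis
      using set_lborel_integral_open_unit[OF contG] by (simp add: G_def c_def)
  qed
  \<comment> \<open>The estimate holds for every \<open>N\<close>, so the threshold is 0.\<close>
  show ?thesis
    using A by (intro exI[of _ "140 + 6 * A"] conjI allI impI exI[of _ 0] main) auto
qed

end
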